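(* Let $\{X_i:i\in\mathcal I\}$ be a family of $k^*$-metrizable spaces. Then the box-product $\square_{i\in\mathcal I}X_i$ is $k^*$-metrizable.
   Context: All topological spaces are Hausdorff; "map" means continuous function. The box-product $\square_{i\in\mathcal I}X_i$ is the Cartesian product $\prod_{i\in\mathcal I}X_i$ with the topology generated by the sets $\prod_{i\in\mathcal I}U_i$, where each $U_i\subset X_i$ is open. A subset is precompact if its closure is compact. A map $f:M\to X$ is subproper if there is $Z\subset M$ with $f(Z)=X$ such that $Z\cap f^{-1}(K)$ is precompact in $M$ for every precompact $K\subset X$. A space is $k^*$-metrizable if it is the image of a metrizable space under a subproper map. *)

theory Defs
  imports "HOL-Analysis.Analysis"
begin

text \<open>Spaces are abstract topologies. The points of a product indexed by \<open>I\<close> are, as for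
  \<^const>\<open>product_topology\<close>, the functions that take the value \<^const>\<open>undefined\<close> outside \<open>I\<close>.\<close>

definition box_product :: "('i \<Rightarrow> 'a topology) \<Rightarrow> 'i set \<Rightarrow> ('i \<Rightarrow> 'a) topology" where
  "box_product X I =
     topology_generated_by {\<Pi>\<^sub>E i\<in>I. U i | U. \<forall>i\<in>I. openin (X i) (U i)}"

definition precompactin :: "'a topology \<Rightarrow> 'a set \<Rightarrow> bool" where
  "precompactin X S \<longleftrightarrow> S \<subseteq> topspace X \<and> compactin X (X closure_of S)"

definition subproper_map :: "'m topology \<Rightarrow> 'a topology \<Rightarrow> ('m \<Rightarrow> 'a) \<Rightarrow> bool" where
  "subproper_map M X f \<longleftrightarrow>
     continuous_map M X f \<and>
     (\<exists>Z. Z \<subseteq> topspace M \<and> f ` Z = topspace X \<and>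
          (\<forall>K. precompactin X K \<longrightarrow> precompactin M (Z \<inter> f -` K)))"

text \<open>A subproper map is onto by definition, so its image is the whole space \<open>X\<close>; spaces are
  Hausdorff by convention. A definition cannot quantify over the type of points of the metrizable
  space \<open>M\<close>. Points of type \<^typ>\<open>nat \<Rightarrow> 'a\<close> suffice: \<open>M\<close> can be shrunk to the closure of a set with
  one point over each point of \<open>X\<close>, and each point of that closure is the limit of a sequence from
  this set. The theorem \<open>k_star_metrizableI\<close> below states that a metrizable space over an arbitrary
  type will do.\<close>

definition k_star_metrizable :: "'a topology \<Rightarrow> bool" where
  "k_star_metrizable X \<longleftrightarrow>
     Hausdorff_space X \<and>
     (\<exists>(M :: (nat \<Rightarrow> 'a) topology) f. metrizable_space M \<and> subproper_map M X f)"

theorem k_star_metrizableI: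
  fixes X :: "'a topology" and M :: "'m topology"
  assumes haus: "Hausdorff_space X" and met: "metrizable_space M" and sub: "subproper_map M X f"
  shows "k_star_metrizable X"
proof -
  have cf: "continuous_map M X f" using sub by (simp add: subproper_map_def)
  obtain Z where ZM: "Z \<subseteq> topspace M" and Zf: "f ` Z = topspace X"
    and Zp: "\<And>K. precompactin X K \<Longrightarrow> precompactin M (Z \<inter> f -` K)"
    using sub unfolding subproper_map_def by blast
  define s where "s = inv_into Z f"
  have s: "s x \<in> Z" "f (s x) = x" if "x \<in> topspace X" for x
    using that Zf by (auto simp: s_def inv_into_into f_inv_into_f)
  define S where "S = s ` topspace X"
  define C where "C = M closure_of S"
  define M' where "M' = subtopology M C"
  have SZ: "S \<subseteq> Z" using s by (auto simp: S_def)
  have SM: "S \<subseteq> topspace M" using SZ ZM by blast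
  have fS: "f ` S = topspace X" using s by (force simp: S_def)
  have SC: "S \<subseteq> C" unfolding C_def by (rule closure_of_subset[OF SM])
  have CM: "C \<subseteq> topspace M" unfolding C_def by (rule closure_of_subset_topspace)
  have cC: "closedin M C" by (simp add: C_def)
  have tM': "topspace M' = C" using CM by (auto simp: M'_def)
  obtain D d where D: "Metric_space D d" "M = Metric_space.mtopology D d"
    using met by (auto simp: metrizable_space_def)
  interpret Metric_space D d by (rule D)
  have "\<exists>\<sigma> :: nat \<Rightarrow> 'a. limitin M (\<lambda>n. s (\<sigma> n)) c sequentially" if "c \<in> C" for c
  proof -
    have "c \<in> mtopology closure_of S" using that by (simp add: C_def D(2))
    then obtain \<tau> where \<tau>: "range \<tau> \<subseteq> S" "limitin M \<tau> c sequentially"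
      unfolding closure_of_sequentially D(2) by auto
    have "s (f (\<tau> n)) = \<tau> n" for n
    proof -
      have "\<tau> n \<in> S" using \<tau>(1) by auto
      then obtain x where "x \<in> topspace X" "\<tau> n = s x" by (auto simp: S_def)
      then show ?thesis using s by simp
    qed
    then show ?thesis using \<tau>(2) by (intro exI[of _ "\<lambda>n. f (\<tau> n)"]) simp
  qed
  then obtain g :: "'m \<Rightarrow> nat \<Rightarrow> 'a"
    where g: "\<And>c. c \<in> C \<Longrightarrow> limitin M (\<lambda>n. s (g c n)) c sequentially" by metis
  have inj: "inj_on g C"
  proof (rule inj_onI)
    fix a b assume "a \<in> C" "b \<in> C" "g a = g b"
    then have "limitin M (\<lambda>n. s (g a n)) a sequentially" "limitin M (\<lambda>n. s (g a n)) b sequentially"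
      using g[of a] g[of b] by simp_all
    then show "a = b"
      using limitin_metric_unique[OF _ _ trivial_limit_sequentially] by (simp add: D(2))
  qed
  define h where "h = inv_into C g"
  have hg: "h (g c) = c" if "c \<in> C" for c using inj that by (simp add: h_def)
  define N where "N = pullback_topology (g ` C) h M'"
  have tN: "topspace N = g ` C"
    using hg by (auto simp: N_def topspace_pullback_topology tM')
  have ch: "continuous_map N M' h"
    unfolding N_def using continuous_map_pullback[OF continuous_map_id, of "g ` C" h M'] by simp
  have cg: "continuous_map M' N g"
  proof -
    have "continuous_map M' M' (h \<circ> g)"
      by (rule continuous_map_eq[OF continuous_map_id]) (simp add: tM' hg)
    then show ?thesis unfolding N_def by (intro continuous_map_pullback') (auto simp: tM')
  qed
  have hom: "homeomorphic_maps M' N g h"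
    using ch cg by (auto simp: homeomorphic_maps_def tM' tN hg)
  then have homg: "homeomorphic_map M' N g" by (simp add: homeomorphic_maps_map)
  have "metrizable_space M'" unfolding M'_def by (rule metrizable_space_subtopology[OF met])
  then have metN: "metrizable_space N"
    using homeomorphic_metrizable_space[of M' N] hom homeomorphic_space_def by blast
  have "continuous_map M' X f" unfolding M'_def by (rule continuous_map_from_subtopology[OF cf])
  then have cfh: "continuous_map N X (f \<circ> h)" by (rule continuous_map_compose[OF ch])
  have img: "(f \<circ> h) ` (g ` S) = topspace X"
  proof -
    have "h ` g ` S = S" using hg SC by force
    then show ?thesis using fS by (simp only: image_comp [symmetric])
  qed
  have pre: "precompactin N (g ` S \<inter> (f \<circ> h) -` K)" if "precompactin X K" for K
  proof -
    define A where "A = S \<inter> f -` K"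
    have eq: "g ` S \<inter> (f \<circ> h) -` K = g ` A" using hg SC by (auto simp: A_def)
    have AC: "A \<subseteq> C" using SC by (auto simp: A_def)
    have "A \<subseteq> Z \<inter> f -` K" using SZ by (auto simp: A_def)
    then have "M closure_of A \<subseteq> M closure_of (Z \<inter> f -` K)" by (rule closure_of_mono)
    then have "compactin M (M closure_of A)"
      using Zp[OF that] closed_compactin closedin_closure_of unfolding precompactin_def by blast
    moreover have "M closure_of A \<subseteq> C" by (rule closure_of_minimal[OF AC cC])
    moreover have "M' closure_of A = C \<inter> M closure_of A"
      using AC by (simp add: M'_def closure_of_subtopology Int_absorb1)
    ultimately have "compactin M' (M' closure_of A)"
      by (simp add: M'_def compactin_subtopology Int_absorb1)
    moreover have "N closure_of (g ` A) = g ` (M' closure_of A)"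
      using homeomorphic_map_closure_of[OF homg] AC tM' by simp
    ultimately have "compactin N (N closure_of (g ` A))"
      using image_compactin[OF _ cg] by simp
    then show ?thesis using AC unfolding eq precompactin_def tN by blast
  qed
  have "subproper_map N X (f \<circ> h)"
    unfolding subproper_map_def
  proof (intro conjI exI[of _ "g ` S"] allI impI)
    show "g ` S \<subseteq> topspace N" unfolding tN by (rule image_mono[OF SC])
  qed (fact cfh, fact img, rule pre)
  then show ?thesis unfolding k_star_metrizable_def using haus metN by blast
qed

end

theory Submission
  imports Defs
begin

text \<open>A box product of metrizable spaces is rarely metrizable, but its compact subsets are small. Call two points
  equivalent if they differ in finitely many coordinates. If \<open>K\<close> is compact, then \<open>K\<close> meets only
  finitely many equivalence classes, and the points of \<open>K\<close> in one class differ from a chosen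
  representative only in a finite set of coordinates that depends on the class and not on the point
  (\<open>compactin_box_product_finite_codes\<close>). The reason is that an open box may shrink in all
  coordinates at once: a set \<open>A\<close> does not accumulate at \<open>q\<close> as soon as all but finitely many
  \<open>x \<in> A\<close> can be excluded from a neighbourhood of \<open>q\<close> by a coordinate of their own
  (\<open>finite_if_separated_by_distinct_coordinates\<close>), while every infinite subset of a compact set has
  an accumulation point.

  Fix a representative \<open>r x\<close> of each class and let \<open>D x\<close> be the finite set of coordinates in which \<open>x\<close>
  differs from \<open>r x\<close>. If \<open>N i \<rightarrow> X i\<close> is subproper with metrizable \<open>N i\<close>, then the finite product
  of the \<open>N i\<close> over \<open>i \<in> F\<close> is metrizable, and for each point \<open>p\<close> it maps continuously to the
  points that agree with \<open>p\<close> off \<open>F\<close>. The topological sum \<open>M\<close> of these products over all pairs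
  \<open>(p, F)\<close> is metrizable and maps onto the box product. Let \<open>S\<close> contain, for each \<open>x\<close>, the lifts of
  \<open>x\<close> in the single summand \<open>(r x, D x)\<close>, with coordinates in the sets that witness subproperness
  of the maps \<open>N i \<rightarrow> X i\<close>. The part of \<open>S\<close> over a compact set lies in finitely many summands, and in
  each of them in a finite product of compact sets.\<close>

section \<open>Topological sums of metrizable spaces\<close>

text \<open>Capping the metrics at 1 and putting different summands at distance 1 keeps the triangle
  inequality, and balls of radius at most 1 stay inside one summand.\<close>
lemma metrizable_space_sum_topology:
  assumes "\<And>i. i \<in> I \<Longrightarrow> metrizable_space (X i)"
  shows "metrizable_space (sum_topology X I)"
proof -
  have "\<forall>i. \<exists>d. i \<in> I \<longrightarrow>
      Metric_space (topspace (X i)) d \<and> X i = Metric_space.mtopology (topspace (X i)) d"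
    using assms Metric_space.topspace_mtopology unfolding metrizable_space_def by metis
  then obtain d where
    d: "\<And>i. i \<in> I \<Longrightarrow> Metric_space (topspace (X i)) (d i)"
    and top: "\<And>i. i \<in> I \<Longrightarrow> X i = Metric_space.mtopology (topspace (X i)) (d i)"
    by metis
  define M where "M = Sigma I (topspace \<circ> X)"
  define D where "D = (\<lambda>(i,x) (j,y). if i = j \<and> i \<in> I then min 1 (d i x y) else (1::real))"
  interpret D: Metric_space M D
  proof
    fix a b c :: "'a \<times> 'b"
    obtain i x j y k z where abc: "a = (i,x)" "b = (j,y)" "c = (k,z)" by (metis surj_pair)
    note nonneg = Metric_space.nonneg[OF d] and commute = Metric_space.commute[OF d]
      and zero = Metric_space.zero[OF d] and triangle = Metric_space.triangle[OF d]
    show "0 \<le> D a b"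
      using nonneg by (auto simp: D_def abc)
    show "D a b = D b a"
      using commute by (auto simp: D_def abc)
    show "(D a b = 0) = (a = b)" if "a \<in> M" "b \<in> M"
    proof (cases "i = j")
      case True
      then show ?thesis using that zero[of i x y] nonneg[of i x y]
        by (auto simp: D_def M_def abc min_def)
    qed (simp add: D_def abc)
    show "D a c \<le> D a b + D b c" if "a \<in> M" "b \<in> M" "c \<in> M"
    proof (cases "i = j \<and> j = k")
      case True
      then have "d i x z \<le> d i x y + d i y z" "0 \<le> d i x y" "0 \<le> d i y z"
        using that triangle nonneg by (simp_all add: M_def abc)
      then show ?thesis using True that by (simp add: D_def M_def abc min_def)
    next
      case False
      have "0 \<le> d i x y" "0 \<le> d k y z" using that nonneg by (simp_all add: M_def abc)
      then show ?thesis using False that by (auto simp: D_def M_def abc min_def)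
    qed
  qed
  have "openin D.mtopology U \<longleftrightarrow> openin (sum_topology X I) U" for U
  proof -
    have "(\<exists>r>0. D.mball (i,x) r \<subseteq> U) \<longleftrightarrow>
          (\<exists>r>0. Metric_space.mball (topspace (X i)) (d i) x r \<subseteq> {y. (i,y) \<in> U})"
      if ix: "i \<in> I" "x \<in> topspace (X i)" for i x
    proof -
      interpret di: Metric_space "topspace (X i)" "d i" by (rule d[OF ix(1)])
      have small: "D.mball (i,x) r = Pair i ` di.mball x r" if "r \<le> 1" for r
      proof (intro set_eqI iffI)
        fix u assume "u \<in> D.mball (i,x) r"
        then show "u \<in> Pair i ` di.mball x r"
          unfolding D.in_mball using that ix by (cases u) (auto simp: D_def M_def split: if_splits)
      next
        fix u assume "u \<in> Pair i ` di.mball x r"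
        then show "u \<in> D.mball (i,x) r"
          unfolding D.in_mball using ix by (auto simp: D_def M_def)
      qed
      show ?thesis
      proof
        assume "\<exists>r>0. D.mball (i,x) r \<subseteq> U"
        then obtain r where "r > 0" "D.mball (i,x) r \<subseteq> U" by blast
        moreover have "D.mball (i,x) (min r 1) \<subseteq> D.mball (i,x) r"
          by (rule D.mball_subset_concentric) simp
        ultimately show "\<exists>r>0. di.mball x r \<subseteq> {y. (i,y) \<in> U}"
          using small[of "min r 1"] by (intro exI[of _ "min r 1"]) auto
      next
        assume "\<exists>r>0. di.mball x r \<subseteq> {y. (i,y) \<in> U}"
        then obtain r where "r > 0" "di.mball x r \<subseteq> {y. (i,y) \<in> U}" by blast
        moreover have "di.mball x (min r 1) \<subseteq> di.mball x r"
          by (rule di.mball_subset_concentric) simp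
        ultimately show "\<exists>r>0. D.mball (i,x) r \<subseteq> U"
          using small[of "min r 1"] by (intro exI[of _ "min r 1"]) auto
      qed
    qed
    note ball = this
    have fibre: "openin (X i) V \<longleftrightarrow> V \<subseteq> topspace (X i) \<and>
        (\<forall>x\<in>V. \<exists>r>0. Metric_space.mball (topspace (X i)) (d i) x r \<subseteq> V)" if "i \<in> I" for i V
      by (subst top[OF that]) (auto simp: Metric_space.openin_mtopology[OF d[OF that]])
    show ?thesis
    proof (cases "U \<subseteq> M")
      case True
      then have "(\<forall>u. u \<in> U \<longrightarrow> (\<exists>r>0. D.mball u r \<subseteq> U)) \<longleftrightarrow>
          (\<forall>i\<in>I. \<forall>x\<in>{y. (i,y) \<in> U}. \<exists>r>0. D.mball (i,x) r \<subseteq> U)"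
        by (auto simp: M_def)
      moreover have "{y. (i,y) \<in> U} \<subseteq> topspace (X i)" for i
        using True by (auto simp: M_def)
      ultimately show ?thesis
        using True ball unfolding D.openin_mtopology openin_sum_topology
        by (simp add: fibre M_def subset_iff)
    next
      case False
      then show ?thesis unfolding D.openin_mtopology openin_sum_topology by (simp add: M_def)
    qed
  qed
  then have "sum_topology X I = D.mtopology" by (simp add: topology_eq)
  then show ?thesis using D.metrizable_space_mtopology by simp
qed

section \<open>Box products\<close>

lemma topspace_box_product: "topspace (box_product X I) = (\<Pi>\<^sub>E i\<in>I. topspace (X i))"
proof -
  let ?C = "{\<Pi>\<^sub>E i\<in>I. U i | U. \<forall>i\<in>I. openin (X i) (U i)}"
  have "\<Union>?C = (\<Pi>\<^sub>E i\<in>I. topspace (X i))"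
  proof (rule antisym)
    show "\<Union>?C \<subseteq> (\<Pi>\<^sub>E i\<in>I. topspace (X i))"
    proof (rule Union_least)
      fix W assume "W \<in> ?C"
      then obtain U where W: "W = (\<Pi>\<^sub>E i\<in>I. U i)" and U: "\<forall>i\<in>I. openin (X i) (U i)" by auto
      show "W \<subseteq> (\<Pi>\<^sub>E i\<in>I. topspace (X i))"
        unfolding W using U openin_subset by (intro PiE_mono) auto
    qed
    have "(\<Pi>\<^sub>E i\<in>I. topspace (X i)) \<in> ?C" by (intro CollectI exI[of _ "\<lambda>i. topspace (X i)"]) simp
    then show "(\<Pi>\<^sub>E i\<in>I. topspace (X i)) \<subseteq> \<Union>?C" by (rule Union_upper)
  qed
  then show ?thesis by (simp add: box_product_def)
qed

lemma openin_box_product_PiE: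
  "(\<And>i. i \<in> I \<Longrightarrow> openin (X i) (U i)) \<Longrightarrow> openin (box_product X I) (\<Pi>\<^sub>E i\<in>I. U i)"
  unfolding box_product_def by (rule topology_generated_by_Basis) blast

lemma continuous_map_box_productI:
  assumes "f \<in> topspace T \<rightarrow> topspace (box_product X I)"
    and "\<And>U. (\<And>i. i \<in> I \<Longrightarrow> openin (X i) (U i)) \<Longrightarrow>
      openin T (f -` (\<Pi>\<^sub>E i\<in>I. U i) \<inter> topspace T)"
  shows "continuous_map T (box_product X I) f"
  unfolding box_product_def
proof (rule continuous_on_generated_topo)
  show "f ` topspace T \<subseteq> \<Union>{\<Pi>\<^sub>E i\<in>I. U i | U. \<forall>i\<in>I. openin (X i) (U i)}"
    using assms(1) by (auto simp: box_product_def)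
qed (use assms(2) in blast)

lemma continuous_map_box_product_projection:
  assumes "i \<in> I"
  shows "continuous_map (box_product X I) (X i) (\<lambda>x. x i)"
  unfolding continuous_map_def
proof (intro conjI allI impI)
  show "(\<lambda>x. x i) \<in> topspace (box_product X I) \<rightarrow> topspace (X i)"
    using assms by (auto simp: topspace_box_product)
next
  fix V assume V: "openin (X i) V"
  have "{x \<in> topspace (box_product X I). x i \<in> V} =
      (\<Pi>\<^sub>E j\<in>I. if j = i then V else topspace (X j))"
    (is "_ = (\<Pi>\<^sub>E j\<in>I. ?W j)")
  proof (intro set_eqI iffI)
    fix x assume "x \<in> {x \<in> topspace (box_product X I). x i \<in> V}"
    then show "x \<in> (\<Pi>\<^sub>E j\<in>I. ?W j)" by (auto simp: topspace_box_product PiE_iff)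
  next
    fix x assume x: "x \<in> (\<Pi>\<^sub>E j\<in>I. ?W j)"
    have "(\<Pi>\<^sub>E j\<in>I. ?W j) \<subseteq> (\<Pi>\<^sub>E j\<in>I. topspace (X j))"
      using openin_subset[OF V] by (intro PiE_mono) auto
    moreover have "x i \<in> V" using PiE_mem[OF x assms] by simp
    ultimately show "x \<in> {x \<in> topspace (box_product X I). x i \<in> V}"
      using x by (auto simp only: topspace_box_product)
  qed
  also have "openin (box_product X I) \<dots>"
    using V by (intro openin_box_product_PiE) auto
  finally show "openin (box_product X I) {x \<in> topspace (box_product X I). x i \<in> V}" .
qed

lemma Hausdorff_space_box_product:
  assumes "\<And>i. i \<in> I \<Longrightarrow> Hausdorff_space (X i)"
  shows "Hausdorff_space (box_product X I)"
  unfolding Hausdorff_space_def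
proof (intro allI impI, elim conjE)
  fix x y assume xy: "x \<in> topspace (box_product X I)" "y \<in> topspace (box_product X I)" "x \<noteq> y"
  have "\<exists>i\<in>I. x i \<noteq> y i"
  proof (rule ccontr)
    assume "\<not> (\<exists>i\<in>I. x i \<noteq> y i)"
    then have "x = y"
      using PiE_ext[OF xy(1,2)[unfolded topspace_box_product]] by simp
    then show False using xy(3) by contradiction
  qed
  then obtain i where i: "i \<in> I" "x i \<noteq> y i" by blast
  then have "x i \<in> topspace (X i)" "y i \<in> topspace (X i)"
    using xy by (auto simp: topspace_box_product)
  then obtain U V where UV: "openin (X i) U" "openin (X i) V" "x i \<in> U" "y i \<in> V" "disjnt U V"
    using assms[OF i(1)] i(2) unfolding Hausdorff_space_def by blast
  have pre: "openin (box_product X I) {z \<in> topspace (box_product X I). z i \<in> W}"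
    if "openin (X i) W" for W
    using continuous_map_box_product_projection[OF i(1)] that by (rule openin_continuous_map_preimage)
  show "\<exists>U V. openin (box_product X I) U \<and> openin (box_product X I) V \<and>
      x \<in> U \<and> y \<in> V \<and> disjnt U V"
  proof (intro exI conjI)
    show "openin (box_product X I) {z \<in> topspace (box_product X I). z i \<in> U}" by (rule pre[OF UV(1)])
    show "openin (box_product X I) {z \<in> topspace (box_product X I). z i \<in> V}" by (rule pre[OF UV(2)])
    show "x \<in> {z \<in> topspace (box_product X I). z i \<in> U}" using xy(1) UV(3) by simp
    show "y \<in> {z \<in> topspace (box_product X I). z i \<in> V}" using xy(2) UV(4) by simp
    show "disjnt {z \<in> topspace (box_product X I). z i \<in> U} {z \<in> topspace (box_product X I). z i \<in> V}"
      using UV(5) by (simp add: disjnt_iff)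
  qed
qed

section \<open>Compact subsets of box products\<close>

text \<open>An open box may restrict infinitely many coordinates at once. For each
  \<open>q\<close>, the point \<open>x\<close> is removed from
  the box around \<open>q\<close> in the coordinate \<open>j x\<close>. Since \<open>j\<close> is injective, at most one point is removed
  per coordinate, so the box is open, and it meets \<open>A\<close> only in the finite set \<open>B\<close>. Hence \<open>A\<close> has no
  accumulation point.\<close>
lemma finite_if_separated_by_distinct_coordinates:
  assumes haus: "\<And>i. i \<in> I \<Longrightarrow> Hausdorff_space (X i)"
    and K: "compactin (box_product X I) K" and AK: "A \<subseteq> K"
    and sep: "\<And>q. q \<in> topspace (box_product X I) \<Longrightarrow>
      \<exists>B j. finite B \<and> inj_on j (A - B) \<and> (\<forall>x\<in>A - B. j x \<in> I \<and> x (j x) \<noteq> q (j x))"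
  shows "finite A"
proof (rule ccontr)
  assume "infinite A"
  then obtain q where q: "q \<in> box_product X I derived_set_of A"
    using compactin_imp_Bolzano_Weierstrass[OF K, of A] AK by auto
  have H: "Hausdorff_space (box_product X I)" by (rule Hausdorff_space_box_product[OF haus])
  have qT: "q \<in> topspace (box_product X I)"
    and acc: "\<And>U. q \<in> U \<Longrightarrow> openin (box_product X I) U \<Longrightarrow> infinite (A \<inter> U)"
    using q by (simp_all add: derived_set_of_infinite_openin[OF H])
  obtain B j where B: "finite B" and inj: "inj_on j (A - B)"
    and j: "\<And>x. x \<in> A - B \<Longrightarrow> j x \<in> I \<and> x (j x) \<noteq> q (j x)"
    using sep[OF qT] by metis
  define U where "U = (\<lambda>i. topspace (X i) - {x i | x. x \<in> A - B \<and> j x = i})"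
  have "openin (X i) (U i)" if i: "i \<in> I" for i
  proof -
    define E where "E = {x i | x. x \<in> A - B \<and> j x = i}"
    have "E = {} \<or> (\<exists>a. E = {a})"
      using inj unfolding E_def inj_on_def by blast
    then have "finite E" by auto
    moreover have "E \<subseteq> topspace (X i)"
      using AK compactin_subset_topspace[OF K] i
      by (fastforce simp: E_def topspace_box_product)
    ultimately have "closedin (X i) E"
      using Hausdorff_imp_t1_space[OF haus[OF i]] by (simp add: t1_space_closedin_finite)
    then show ?thesis unfolding U_def E_def by blast
  qed
  then have "openin (box_product X I) (\<Pi>\<^sub>E i\<in>I. U i)" by (rule openin_box_product_PiE)
  moreover have "q \<in> (\<Pi>\<^sub>E i\<in>I. U i)"
    using qT j by (auto simp: U_def topspace_box_product PiE_iff) metis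
  ultimately have "infinite (A \<inter> (\<Pi>\<^sub>E i\<in>I. U i))" by (rule acc[rotated])
  moreover have "A \<inter> (\<Pi>\<^sub>E i\<in>I. U i) \<subseteq> B"
    using j by (fastforce simp: U_def PiE_iff)
  ultimately show False using B finite_subset by blast
qed

text \<open>Countably many infinite sets have distinct representatives: choose them one after the other,
  avoiding the finitely many earlier choices.\<close>
lemma countable_infinite_sets_injective_choice:
  assumes "countable A" and "\<And>x. x \<in> A \<Longrightarrow> infinite (S x)"
  obtains j where "inj_on j A" and "\<And>x. x \<in> A \<Longrightarrow> j x \<in> S x"
proof -
  define e where "e = to_nat_on A"
  \<comment> \<open>The enumeration of \<open>A\<close> need not hit every natural number; the gaps are filled with an arbitrary
    set of the family, so that the recursion never meets an empty set.\<close>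
  define R where "R = (\<lambda>n. if n \<in> e ` A then S (inv_into A e n) else S (SOME x. x \<in> A))"
  have e: "inj_on e A" unfolding e_def by (rule inj_on_to_nat_on[OF assms(1)])
  show thesis
  proof (cases "A = {}")
    case False
    then have R: "infinite (R n)" for n
      using assms(2) by (auto simp: R_def inv_into_into some_in_eq)
    have "\<exists>f. \<forall>n::nat. f n \<in> R n \<and> f n \<notin> f ` {..<n}"
    proof (rule dependent_wellorder_choice)
      fix r and f g :: "nat \<Rightarrow> 'b" and n :: nat
      assume "\<And>m. m < n \<Longrightarrow> f m = g m"
      then have "f ` {..<n} = g ` {..<n}" by (intro image_cong) auto
      then show "(r \<in> R n \<and> r \<notin> f ` {..<n}) = (r \<in> R n \<and> r \<notin> g ` {..<n})" by simp
    next
      fix n :: nat and f :: "nat \<Rightarrow> 'b"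
      show "\<exists>r. r \<in> R n \<and> r \<notin> f ` {..<n}"
        using R[of n] finite_subset[of "R n" "f ` {..<n}"] by blast
    qed
    then obtain f where f: "\<And>n. f n \<in> R n" "\<And>n. f n \<notin> f ` {..<n::nat}" by blast
    have "inj f"
    proof (rule linorder_injI)
      fix m n :: nat assume "m < n"
      then have "f m \<in> f ` {..<n}" by simp
      then show "f m \<noteq> f n" using f(2)[of n] by metis
    qed
    then have "inj_on (f \<circ> e) A" using e by (simp add: comp_inj_on inj_on_subset)
    moreover have "(f \<circ> e) x \<in> S x" if "x \<in> A" for x
      using f(1)[of "e x"] that e by (simp add: R_def)
    ultimately show thesis by (rule that)
  qed (use that in simp)
qed

definition differing :: "'i set \<Rightarrow> ('i \<Rightarrow> 'a) \<Rightarrow> ('i \<Rightarrow> 'a) \<Rightarrow> 'i set" where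
  "differing I x y = {i \<in> I. x i \<noteq> y i}"

lemma differing_commute: "differing I x y = differing I y x"
  by (auto simp: differing_def)

lemma finite_differing_trans:
  assumes "finite (differing I x y)" "finite (differing I y z)"
  shows "finite (differing I x z)"
  by (rule finite_subset[OF _ finite_UnI[OF assms]]) (auto simp: differing_def)

text \<open>Take infinitely many points of \<open>K\<close> in different classes. All but at most one of them differ from
  a given \<open>q\<close> in infinitely many coordinates, so distinct coordinates can be chosen for them. The map
  \<open>r\<close> is any invariant of the equivalence classes.\<close>
lemma compactin_box_product_finite_classes:
  assumes haus: "\<And>i. i \<in> I \<Longrightarrow> Hausdorff_space (X i)"
    and K: "compactin (box_product X I) K"
    and r: "\<And>x y. x \<in> K \<Longrightarrow> y \<in> K \<Longrightarrow> finite (differing I x y) \<Longrightarrow> r x = r y"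
  shows "finite (r ` K)"
proof (rule ccontr)
  assume "infinite (r ` K)"
  then obtain R where R: "R \<subseteq> r ` K" "countable R" "infinite R"
    using infinite_countable_subset' by metis
  define A where "A = inv_into K r ` R"
  have AK: "A \<subseteq> K" using R(1) by (auto simp: A_def inv_into_into)
  have "inj_on (inv_into K r) R" using R(1) by (rule inj_on_inv_into)
  then have infA: "infinite A" using R(3) by (simp add: A_def finite_image_iff)
  have rA: "inj_on r A"
    using R(1) by (intro inj_onI) (auto simp: A_def f_inv_into_f subset_iff)
  have "finite A"
  proof (rule finite_if_separated_by_distinct_coordinates[OF haus K AK])
    fix q
    define B where "B = {x \<in> A. finite (differing I x q)}"
    have "x = y" if "x \<in> B" "y \<in> B" for x y
    proof -
      have "finite (differing I x y)"
        using that finite_differing_trans[of I x q y] by (simp add: B_def differing_commute)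
      then have "r x = r y" using that AK by (intro r) (auto simp: B_def)
      then show ?thesis using rA that by (auto simp: B_def inj_on_def)
    qed
    then have "B = {} \<or> (\<exists>b. B = {b})" by blast
    then have "finite B" by auto
    moreover have "countable (A - B)" using R(2) by (simp add: A_def)
    then obtain j where "inj_on j (A - B)" "\<And>x. x \<in> A - B \<Longrightarrow> j x \<in> differing I x q"
      by (rule countable_infinite_sets_injective_choice[where S = "\<lambda>x. differing I x q"])
        (auto simp: B_def)
    ultimately show "\<exists>B j. finite B \<and> inj_on j (A - B) \<and>
        (\<forall>x\<in>A - B. j x \<in> I \<and> x (j x) \<noteq> q (j x))"
      unfolding differing_def by blast
  qed
  then show False using infA by contradiction
qed

text \<open>If infinitely many coordinates occurred, each could be assigned a point of \<open>L\<close> that differs from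
  \<open>p\<close> there. Infinitely many points arise in this way, and the coordinates assigned to them separate
  almost all of them from every \<open>q\<close> in the class of \<open>p\<close>, which agrees with \<open>p\<close> almost everywhere.
  From a \<open>q\<close> outside the class of \<open>p\<close>, all of them differ in infinitely many coordinates.\<close>
lemma compactin_box_product_finite_support:
  assumes haus: "\<And>i. i \<in> I \<Longrightarrow> Hausdorff_space (X i)"
    and K: "compactin (box_product X I) K"
    and LK: "L \<subseteq> K" and L: "\<And>x. x \<in> L \<Longrightarrow> finite (differing I x p)"
  shows "finite (\<Union>x\<in>L. differing I x p)"
proof (rule ccontr)
  assume "infinite (\<Union>x\<in>L. differing I x p)"
  then obtain E where E: "E \<subseteq> (\<Union>x\<in>L. differing I x p)" "countable E" "infinite E"
    using infinite_countable_subset' by metis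
  have "\<forall>i\<in>E. \<exists>x. x \<in> L \<and> i \<in> differing I x p" using E(1) by blast
  then obtain w where "\<forall>i\<in>E. w i \<in> L \<and> i \<in> differing I (w i) p" by (rule bchoice[THEN exE])
  then have w: "w i \<in> L \<and> i \<in> differing I (w i) p" if "i \<in> E" for i using that by blast
  define A where "A = w ` E"
  have AL: "A \<subseteq> L" using w by (auto simp: A_def)
  have infA: "infinite A"
  proof
    assume "finite A"
    then have "finite (\<Union>x\<in>A. differing I x p)" using L AL by blast
    moreover have "E \<subseteq> (\<Union>x\<in>A. differing I x p)" using w by (auto simp: A_def)
    ultimately show False using E(3) finite_subset by blast
  qed
  have "finite A"
  proof (rule finite_if_separated_by_distinct_coordinates[OF haus K])
    show "A \<subseteq> K" using AL LK by blast
  next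
    fix q
    show "\<exists>B j. finite B \<and> inj_on j (A - B) \<and> (\<forall>x\<in>A - B. j x \<in> I \<and> x (j x) \<noteq> q (j x))"
    proof (cases "finite (differing I q p)")
      case True
      define j where "j = inv_into E w"
      have inj: "inj_on j A" unfolding j_def A_def by (rule inj_on_inv_into) simp
      have j: "j x \<in> differing I x p" if "x \<in> A" for x
        using w[of "j x"] that by (simp add: j_def A_def inv_into_into f_inv_into_f)
      define B where "B = {x \<in> A. j x \<in> differing I q p}"
      have "finite (j ` B)" by (rule finite_subset[OF _ True]) (auto simp: B_def)
      then have "finite B" using inj_on_subset[OF inj, of B] by (simp add: B_def finite_image_iff)
      moreover have "inj_on j (A - B)" using inj by (rule inj_on_diff)
      moreover have "\<forall>x\<in>A - B. j x \<in> I \<and> x (j x) \<noteq> q (j x)"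
        using j by (fastforce simp: B_def differing_def)
      ultimately show ?thesis by blast
    next
      case False
      have "infinite (differing I x q)" if "x \<in> A" for x
        using False L[of x] AL that finite_differing_trans[of I q x p]
        by (auto simp: differing_commute)
      moreover have "countable A" using E(2) by (simp add: A_def)
      ultimately obtain j where "inj_on j A" "\<And>x. x \<in> A \<Longrightarrow> j x \<in> differing I x q"
        using countable_infinite_sets_injective_choice[where S = "\<lambda>x. differing I x q"] by metis
      then show ?thesis unfolding differing_def
        by (intro exI[of _ "{}"] exI[of _ j]) auto
    qed
  qed
  then show False using infA by contradiction
qed

text \<open>A point is described, up to the values in finitely many coordinates, by the representative of its
  class and the set of coordinates in which it differs from that representative.\<close>
lemma compactin_box_product_finite_codes:
  assumes haus: "\<And>i. i \<in> I \<Longrightarrow> Hausdorff_space (X i)"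
    and K: "compactin (box_product X I) K"
    and r: "\<And>x y. x \<in> K \<Longrightarrow> y \<in> K \<Longrightarrow> finite (differing I x y) \<Longrightarrow> r x = r y"
    and fin: "\<And>x. x \<in> K \<Longrightarrow> finite (differing I x (r x))"
  shows "finite ((\<lambda>x. (r x, differing I x (r x))) ` K)"
proof -
  define E where "E = (\<lambda>p. \<Union>x\<in>{x \<in> K. r x = p}. differing I x p)"
  have "finite (E p)" for p
    unfolding E_def
    by (rule compactin_box_product_finite_support[OF haus K]) (use fin in auto)
  moreover have "finite (r ` K)"
    by (rule compactin_box_product_finite_classes[OF haus K r])
  ultimately have "finite (Sigma (r ` K) (\<lambda>p. Pow (E p)))" by simp
  moreover have "(\<lambda>x. (r x, differing I x (r x))) ` K \<subseteq> Sigma (r ` K) (\<lambda>p. Pow (E p))"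
    by (auto simp: E_def)
  ultimately show ?thesis by (rule finite_subset[rotated])
qed

section \<open>Box products of \<open>k\<^sup>*\<close>-metrizable spaces\<close>

lemma precompactin_subset_compactin:
  assumes "Hausdorff_space X" "compactin X C" "S \<subseteq> C"
  shows "precompactin X S"
proof -
  have "X closure_of S \<subseteq> C"
    using assms compactin_imp_closedin closure_of_minimal by blast
  then have "compactin X (X closure_of S)"
    using assms(2) closed_compactin closedin_closure_of by blast
  then show ?thesis
    using assms compactin_subset_topspace unfolding precompactin_def by blast
qed

text \<open>The preimage of an open box is an open box in the finite product, or empty if \<open>p\<close> violates one of
  the conditions off \<open>F\<close>. Only the finiteness of \<open>F\<close> makes the former open in the product topology.\<close>
lemma continuous_map_box_product_finite_modification:
  assumes \<phi>: "\<And>i. i \<in> F \<Longrightarrow> continuous_map (N i) (X i) (\<phi> i)"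
    and F: "finite F" "F \<subseteq> I" and p: "p \<in> topspace (box_product X I)"
  shows "continuous_map (product_topology N F) (box_product X I)
           (\<lambda>m i. if i \<in> F then \<phi> i (m i) else p i)" (is "continuous_map _ _ ?f")
proof (rule continuous_map_box_productI)
  show "?f \<in> topspace (product_topology N F) \<rightarrow> topspace (box_product X I)"
    using F(2) p continuous_map_image_subset_topspace[OF \<phi>]
    by (fastforce simp: topspace_box_product PiE_iff extensional_def)
next
  fix U assume U: "\<And>i. i \<in> I \<Longrightarrow> openin (X i) (U i)"
  show "openin (product_topology N F)
      (?f -` (\<Pi>\<^sub>E i\<in>I. U i) \<inter> topspace (product_topology N F))"
  proof (cases "\<forall>i\<in>I - F. p i \<in> U i")
    case True
    have "?f -` (\<Pi>\<^sub>E i\<in>I. U i) \<inter> topspace (product_topology N F) =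
        (\<Pi>\<^sub>E i\<in>F. {y \<in> topspace (N i). \<phi> i y \<in> U i})"
      using True F(2) p by (fastforce simp: topspace_box_product PiE_iff extensional_def)
    also have "openin (product_topology N F) \<dots>"
      using F U openin_continuous_map_preimage[OF \<phi>]
      by (subst openin_PiE_gen) auto
    finally show ?thesis .
  next
    case False
    then have "?f -` (\<Pi>\<^sub>E i\<in>I. U i) \<inter> topspace (product_topology N F) = {}"
      by (fastforce simp: PiE_iff)
    then show ?thesis by simp
  qed
qed

lemma continuous_map_from_sum_topology:
  assumes "\<And>i. i \<in> I \<Longrightarrow> continuous_map (X i) Y (\<lambda>x. f (i,x))"
  shows "continuous_map (sum_topology X I) Y f"
  unfolding continuous_map_def
proof (intro conjI allI impI)
  show "f \<in> topspace (sum_topology X I) \<rightarrow> topspace Y"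
    using continuous_map_image_subset_topspace[OF assms] by fastforce
next
  fix U assume "openin Y U"
  then have "openin (X i) {x \<in> topspace (X i). f (i,x) \<in> U}" if "i \<in> I" for i
    by (rule openin_continuous_map_preimage[OF assms[OF that]])
  then show "openin (sum_topology X I) {x \<in> topspace (sum_topology X I). f x \<in> U}"
    by (auto simp: openin_sum_topology)
qed

theorem theorem3p10:
  fixes X :: "'i \<Rightarrow> 'a topology" and I :: "'i set"
  assumes "\<And>i. i \<in> I \<Longrightarrow> k_star_metrizable (X i)"
  shows "k_star_metrizable (box_product X I)"
proof -
  have haus: "Hausdorff_space (X i)" if "i \<in> I" for i
    using assms[OF that] by (simp add: k_star_metrizable_def)
  have "\<forall>i. \<exists>(N :: (nat \<Rightarrow> 'a) topology) \<phi>. i \<in> I \<longrightarrow> metrizable_space N \<and> subproper_map N (X i) \<phi>"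
    using assms unfolding k_star_metrizable_def by blast
  then obtain N :: "'i \<Rightarrow> (nat \<Rightarrow> 'a) topology" and \<phi> where
    N: "\<And>i. i \<in> I \<Longrightarrow> metrizable_space (N i)"
    and sub: "\<And>i. i \<in> I \<Longrightarrow> subproper_map (N i) (X i) (\<phi> i)"
    by metis
  have \<phi>: "continuous_map (N i) (X i) (\<phi> i)" if "i \<in> I" for i
    using sub[OF that] by (simp add: subproper_map_def)
  have "\<forall>i\<in>I. \<exists>Z. Z \<subseteq> topspace (N i) \<and> \<phi> i ` Z = topspace (X i) \<and>
      (\<forall>K. precompactin (X i) K \<longrightarrow> precompactin (N i) (Z \<inter> \<phi> i -` K))"
    using sub by (simp add: subproper_map_def)
  then obtain Z where Z: "\<forall>i\<in>I. Z i \<subseteq> topspace (N i) \<and> \<phi> i ` Z i = topspace (X i) \<and>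
      (\<forall>K. precompactin (X i) K \<longrightarrow> precompactin (N i) (Z i \<inter> \<phi> i -` K))"
    by (rule bchoice[THEN exE])
  have ZN: "Z i \<subseteq> topspace (N i)" and Zonto: "\<phi> i ` Z i = topspace (X i)"
    and Zpre: "\<And>K. precompactin (X i) K \<Longrightarrow> precompactin (N i) (Z i \<inter> \<phi> i -` K)"
    if "i \<in> I" for i
    using Z that by simp_all
  let ?B = "box_product X I"
  define r where "r = (\<lambda>x. SOME y. y \<in> topspace ?B \<and> finite (differing I x y))"
  have r: "r x \<in> topspace ?B" "finite (differing I x (r x))" if "x \<in> topspace ?B" for x
  proof -
    have "x \<in> topspace ?B \<and> finite (differing I x x)" using that by (simp add: differing_def)
    then have "r x \<in> topspace ?B \<and> finite (differing I x (r x))" unfolding r_def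
      by (rule someI[where P = "\<lambda>y. y \<in> topspace ?B \<and> finite (differing I x y)"])
    then show "r x \<in> topspace ?B" "finite (differing I x (r x))" by auto
  qed
  have r_eq: "r x = r y" if "finite (differing I x y)" for x y
  proof -
    have "finite (differing I x z) \<longleftrightarrow> finite (differing I y z)" for z
      using that finite_differing_trans[of I x y z] finite_differing_trans[of I y x z]
      by (auto simp: differing_commute)
    then show ?thesis by (simp add: r_def)
  qed
  define code where "code = (\<lambda>x. (r x, differing I x (r x)))"
  define J where "J = topspace ?B \<times> {F. finite F \<and> F \<subseteq> I}"
  define Y where "Y = (\<lambda>k::('i \<Rightarrow> 'a) \<times> 'i set. product_topology N (snd k))"
  define M where "M = sum_topology Y J"
  define f where "f = (\<lambda>((p, F), m) i. if i \<in> F then \<phi> i (m i) else p i)"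
  \<comment> \<open>A point of the box product has lifts in many summands of \<open>M\<close>. Only those in the summand given by
    its code are kept, since a compact set has finitely many codes.\<close>
  define S where "S = {(code x, m) | x m. x \<in> topspace ?B \<and> m \<in> (\<Pi>\<^sub>E i\<in>snd (code x). Z i) \<and>
      (\<forall>i\<in>snd (code x). \<phi> i (m i) = x i)}"
  have codeJ: "code x \<in> J" if "x \<in> topspace ?B" for x
    using r[OF that] by (auto simp: code_def J_def differing_def)
  have fS: "f (code x, m) = x"
    if "x \<in> topspace ?B" "\<forall>i\<in>snd (code x). \<phi> i (m i) = x i" for x m
  proof
    fix i
    show "f (code x, m) i = x i"
      using that r(1)[OF that(1)]
      by (cases "i \<in> I") (auto simp: f_def code_def differing_def topspace_box_product PiE_iff extensional_def)
  qed
  have metM: "metrizable_space M"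
    unfolding M_def
  proof (rule metrizable_space_sum_topology)
    fix k assume "k \<in> J"
    then have "finite (snd k)" "snd k \<subseteq> I" by (auto simp: J_def)
    moreover from this have "countable {i \<in> snd k. \<nexists>a. topspace (N i) \<subseteq> {a}}"
      by (simp add: countable_finite)
    ultimately show "metrizable_space (Y k)"
      unfolding Y_def metrizable_space_product_topology using N by blast
  qed
  have "subproper_map M ?B f"
    unfolding subproper_map_def
  proof (intro conjI exI[of _ S] allI impI)
    show "continuous_map M ?B f"
      unfolding M_def
    proof (rule continuous_map_from_sum_topology)
      fix k assume "k \<in> J"
      then obtain p F where k: "k = (p, F)" "p \<in> topspace ?B" "finite F" "F \<subseteq> I"
        by (auto simp: J_def)
      have "continuous_map (product_topology N F) ?B (\<lambda>m i. if i \<in> F then \<phi> i (m i) else p i)"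
        using k \<phi> by (intro continuous_map_box_product_finite_modification) auto
      then show "continuous_map (Y k) ?B (\<lambda>m. f (k, m))"
        by (simp add: Y_def f_def k(1))
    qed
    show "S \<subseteq> topspace M"
    proof
      fix s assume "s \<in> S"
      then obtain x m where s: "s = (code x, m)" "x \<in> topspace ?B"
        "m \<in> (\<Pi>\<^sub>E i\<in>snd (code x). Z i)"
        by (auto simp: S_def)
      have "(\<Pi>\<^sub>E i\<in>snd (code x). Z i) \<subseteq> (\<Pi>\<^sub>E i\<in>snd (code x). topspace (N i))"
        using ZN by (intro PiE_mono) (auto simp: code_def differing_def)
      then have "m \<in> topspace (Y (code x))" using s(3) by (auto simp: Y_def)
      then show "s \<in> topspace M" using s(1) codeJ[OF s(2)] by (simp add: M_def)
    qed
    show "f ` S = topspace ?B"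
    proof
      show "f ` S \<subseteq> topspace ?B" using fS by (auto simp: S_def)
    next
      show "topspace ?B \<subseteq> f ` S"
      proof
        fix x assume x: "x \<in> topspace ?B"
        define m where "m = (\<lambda>i\<in>snd (code x). inv_into (Z i) (\<phi> i) (x i))"
        have "m i \<in> Z i \<and> \<phi> i (m i) = x i" if "i \<in> snd (code x)" for i
        proof -
          have "i \<in> I" using that by (auto simp: code_def differing_def)
          then have "x i \<in> \<phi> i ` Z i" using x Zonto by (auto simp: topspace_box_product)
          then show ?thesis using that by (simp add: m_def inv_into_into f_inv_into_f)
        qed
        then have "(code x, m) \<in> S" "f (code x, m) = x"
          using x fS by (auto simp: S_def m_def)
        then show "x \<in> f ` S" by force
      qed
    qed
    fix K assume "precompactin ?B K"
    define L where "L = ?B closure_of K"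
    have L: "compactin ?B L" and KL: "K \<subseteq> L"
      using \<open>precompactin ?B K\<close> closure_of_subset by (auto simp: precompactin_def L_def)
    have LB: "L \<subseteq> topspace ?B" by (rule compactin_subset_topspace[OF L])
    define C where "C = (\<lambda>i. N i closure_of (Z i \<inter> \<phi> i -` ((\<lambda>x. x i) ` L)))"
    have C: "compactin (N i) (C i)" "Z i \<inter> \<phi> i -` ((\<lambda>x. x i) ` L) \<subseteq> C i" if "i \<in> I" for i
    proof -
      have "compactin (X i) ((\<lambda>x. x i) ` L)"
        by (rule image_compactin[OF L continuous_map_box_product_projection[OF that]])
      then have "precompactin (X i) ((\<lambda>x. x i) ` L)"
        using precompactin_subset_compactin haus[OF that] by blast
      then have "precompactin (N i) (Z i \<inter> \<phi> i -` ((\<lambda>x. x i) ` L))" by (rule Zpre[OF that])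
      then show "compactin (N i) (C i)" "Z i \<inter> \<phi> i -` ((\<lambda>x. x i) ` L) \<subseteq> C i"
        unfolding C_def precompactin_def using closure_of_subset by blast+
    qed
    define Q where "Q = (\<Union>k\<in>code ` L. Pair k ` (\<Pi>\<^sub>E i\<in>snd k. C i))"
    have "finite (code ` L)"
      unfolding code_def
      by (rule compactin_box_product_finite_codes[OF haus L r_eq]) (use LB r in auto)
    moreover have "compactin M (Pair k ` (\<Pi>\<^sub>E i\<in>snd k. C i))" if k: "k \<in> code ` L" for k
    proof -
      have kJ: "k \<in> J" using k codeJ LB by blast
      then have "compactin (Y k) (\<Pi>\<^sub>E i\<in>snd k. C i)"
        using C(1) by (auto simp: Y_def compactin_PiE J_def)
      then show ?thesis
        unfolding M_def by (rule image_compactin[OF _ continuous_map_component_injection[OF kJ]])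
    qed
    ultimately have "compactin M Q" unfolding Q_def by (intro compactin_Union) auto
    moreover have "S \<inter> f -` K \<subseteq> Q"
    proof
      fix s assume s: "s \<in> S \<inter> f -` K"
      then obtain x m where x: "s = (code x, m)" "x \<in> topspace ?B"
        "m \<in> (\<Pi>\<^sub>E i\<in>snd (code x). Z i)" "\<forall>i\<in>snd (code x). \<phi> i (m i) = x i"
        by (auto simp: S_def)
      then have xL: "x \<in> L" using s fS KL by auto
      have "m i \<in> C i" if "i \<in> snd (code x)" for i
      proof -
        have "i \<in> I" using that by (auto simp: code_def differing_def)
        moreover have "m i \<in> Z i \<inter> \<phi> i -` ((\<lambda>x. x i) ` L)" using x xL that by auto
        ultimately show ?thesis using C(2) by blast
      qed
      then have "m \<in> (\<Pi>\<^sub>E i\<in>snd (code x). C i)" using x(3) by (auto simp: PiE_iff)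
      then show "s \<in> Q" using xL x(1) by (auto simp: Q_def)
    qed
    ultimately show "precompactin M (S \<inter> f -` K)"
      by (rule precompactin_subset_compactin[OF metrizable_imp_Hausdorff_space[OF metM]])
  qed
  moreover have "Hausdorff_space ?B" by (rule Hausdorff_space_box_product[OF haus])
  ultimately show ?thesis using metM k_star_metrizableI by blast
qed

end
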